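(* Let $R$ be a clean ring. Then the ring $\mathbb{LTDFM}_{\mathbb{N}}(R)$ of lower-triangular diagonal-finite matrices over $R$ is nil-good clean.
   Context: Rings are associative with unity. A ring $S$ is clean if for every $a \in S$ there are a unit $u \in S$ and an idempotent $e \in S$ with $a = u + e$. A ring $S$ is nil-good clean if for every $a \in S$ there are a nilpotent $n \in S$, an idempotent $e \in S$ and a unit $u \in S$ with $a = n + e + u$. Let $\mathbb{N} = \{1,2,3,\dots\}$ index rows and columns, and let $\mathbb{CFM}_{\mathbb{N}}(R)$ denote the ring of column-finite matrices $A = (a_{ij})_{i,j=1}^{\infty}$ over $R$ (each column has only finitely many nonzero entries), where $i$ is the row index and $j$ the column index. The ring $\mathbb{LTDFM}_{\mathbb{N}}(R)$ is the subring of $\mathbb{CFM}_{\mathbb{N}}(R)$ consisting of all $A = (a_{ij})$ that are lower triangular ($a_{ij} = 0$ whenever $i < j$) and diagonal-finite (there exists $n \in \mathbb{N}$ such that $a_{ij} = 0$ for all $j \geq 1$ and all $i \geq j + n$). *)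

theory Defs
  imports "HOL-Algebra.Subrings"
begin

definition idempotents :: "('a, 'm) ring_scheme \<Rightarrow> 'a set" where
  "idempotents S = {e \<in> carrier S. e \<otimes>\<^bsub>S\<^esub> e = e}"

definition nilpotents :: "('a, 'm) ring_scheme \<Rightarrow> 'a set" where
  "nilpotents S = {x \<in> carrier S. \<exists>k::nat. k > 0 \<and> x [^]\<^bsub>S\<^esub> k = \<zero>\<^bsub>S\<^esub>}"

definition clean_ring :: "('a, 'm) ring_scheme \<Rightarrow> bool" where
  "clean_ring S \<longleftrightarrow> ring S \<and>
     (\<forall>a \<in> carrier S. \<exists>u \<in> Units S. \<exists>e \<in> idempotents S. a = u \<oplus>\<^bsub>S\<^esub> e)"

definition nil_good_clean_ring :: "('a, 'm) ring_scheme \<Rightarrow> bool" where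
  "nil_good_clean_ring S \<longleftrightarrow> ring S \<and>
     (\<forall>a \<in> carrier S. \<exists>n \<in> nilpotents S. \<exists>e \<in> idempotents S. \<exists>u \<in> Units S.
        a = n \<oplus>\<^bsub>S\<^esub> e \<oplus>\<^bsub>S\<^esub> u)"

text \<open>
  Matrices are functions of a row index and a column index, in this order.  Indices start at
  0 instead of 1; all conditions below are invariant under this shift.  The entries of a product
  are sums over the (finite) support of a column of the right factor.
\<close>

definition CFM :: "('a, 'm) ring_scheme \<Rightarrow> (nat \<Rightarrow> nat \<Rightarrow> 'a) ring" where
  "CFM R = \<lparr>
     carrier = {A. (\<forall>i j. A i j \<in> carrier R) \<and> (\<forall>j. finite {i. A i j \<noteq> \<zero>\<^bsub>R\<^esub>})},
     mult = (\<lambda>A B i j. \<Oplus>\<^bsub>R\<^esub>k \<in> {k. B k j \<noteq> \<zero>\<^bsub>R\<^esub>}. A i k \<otimes>\<^bsub>R\<^esub> B k j),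
     one = (\<lambda>i j. if i = j then \<one>\<^bsub>R\<^esub> else \<zero>\<^bsub>R\<^esub>),
     zero = (\<lambda>i j. \<zero>\<^bsub>R\<^esub>),
     add = (\<lambda>A B i j. A i j \<oplus>\<^bsub>R\<^esub> B i j)\<rparr>"

definition lower_triangular :: "('a, 'm) ring_scheme \<Rightarrow> (nat \<Rightarrow> nat \<Rightarrow> 'a) \<Rightarrow> bool" where
  "lower_triangular R A \<longleftrightarrow> (\<forall>i j. i < j \<longrightarrow> A i j = \<zero>\<^bsub>R\<^esub>)"

definition diagonal_finite :: "('a, 'm) ring_scheme \<Rightarrow> (nat \<Rightarrow> nat \<Rightarrow> 'a) \<Rightarrow> bool" where
  "diagonal_finite R A \<longleftrightarrow> (\<exists>n>0. \<forall>j. \<forall>i \<ge> j + n. A i j = \<zero>\<^bsub>R\<^esub>)"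

definition LTDFM :: "('a, 'm) ring_scheme \<Rightarrow> (nat \<Rightarrow> nat \<Rightarrow> 'a) ring" where
  "LTDFM R = (CFM R)\<lparr>carrier :=
     {A \<in> carrier (CFM R). lower_triangular R A \<and> diagonal_finite R A}\<rparr>"

context ring
begin

lemma CFM_mult_eq:
  assumes "A \<in> carrier (CFM R)" "B \<in> carrier (CFM R)"
    and "finite K" "{k. B k j \<noteq> \<zero>} \<subseteq> K"
  shows "(A \<otimes>\<^bsub>CFM R\<^esub> B) i j = (\<Oplus>k\<in>K. A i k \<otimes> B k j)"
proof -
  have *: "\<And>i j. A i j \<in> carrier R" "\<And>i j. B i j \<in> carrier R"
    using assms by (auto simp: CFM_def)
  have "(\<Oplus>k\<in>{k. B k j \<noteq> \<zero>}. A i k \<otimes> B k j) = (\<Oplus>k\<in>K. A i k \<otimes> B k j)"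
    by (rule add.finprod_mono_neutral_cong_left) (use assms(3,4) * in auto)
  then show ?thesis by (simp add: CFM_def)
qed

lemma finsum_swap:
  assumes "finite K" "finite L" "\<And>k l. f k l \<in> carrier R"
  shows "(\<Oplus>k\<in>K. \<Oplus>l\<in>L. f k l) = (\<Oplus>l\<in>L. \<Oplus>k\<in>K. f k l)"
  using assms(1)
proof (induction K rule: finite_induct)
  case empty
  then show ?case by simp
next
  case (insert k K)
  have "(\<Oplus>k\<in>insert k K. \<Oplus>l\<in>L. f k l) = (\<Oplus>l\<in>L. f k l) \<oplus> (\<Oplus>l\<in>L. \<Oplus>k\<in>K. f k l)"
    using insert assms by (subst finsum_insert) auto
  also have "\<dots> = (\<Oplus>l\<in>L. f k l \<oplus> (\<Oplus>k\<in>K. f k l))"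
    using assms by (subst finsum_addf) auto
  also have "\<dots> = (\<Oplus>l\<in>L. \<Oplus>k\<in>insert k K. f k l)"
    using insert assms by (intro finsum_cong') auto
  finally show ?case .
qed

lemma CFM_mult_support:
  assumes "A \<in> carrier (CFM R)" "B \<in> carrier (CFM R)"
  shows "{i. (A \<otimes>\<^bsub>CFM R\<^esub> B) i j \<noteq> \<zero>} \<subseteq> (\<Union>k\<in>{k. B k j \<noteq> \<zero>}. {i. A i k \<noteq> \<zero>})"
proof
  fix i assume i: "i \<in> {i. (A \<otimes>\<^bsub>CFM R\<^esub> B) i j \<noteq> \<zero>}"
  show "i \<in> (\<Union>k\<in>{k. B k j \<noteq> \<zero>}. {i. A i k \<noteq> \<zero>})"
  proof (rule ccontr)
    assume "\<not> ?thesis"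
    then have "(\<Oplus>k\<in>{k. B k j \<noteq> \<zero>}. A i k \<otimes> B k j) = (\<Oplus>k\<in>{k. B k j \<noteq> \<zero>}. \<zero>)"
      using assms by (intro finsum_cong') (auto simp: CFM_def)
    then show False using i by (simp add: CFM_def)
  qed
qed

lemma CFM_mult_closed:
  assumes "A \<in> carrier (CFM R)" "B \<in> carrier (CFM R)"
  shows "A \<otimes>\<^bsub>CFM R\<^esub> B \<in> carrier (CFM R)"
proof -
  have *: "\<And>i j. A i j \<in> carrier R" "\<And>i j. B i j \<in> carrier R"
    and fin: "\<And>j. finite {i. A i j \<noteq> \<zero>}" "\<And>j. finite {i. B i j \<noteq> \<zero>}"
    using assms by (auto simp: CFM_def)
  have "(A \<otimes>\<^bsub>CFM R\<^esub> B) i j \<in> carrier R" for i j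
    using * by (auto simp: CFM_def intro!: finsum_closed)
  moreover have "finite {i. (A \<otimes>\<^bsub>CFM R\<^esub> B) i j \<noteq> \<zero>}" for j
    by (rule finite_subset[OF CFM_mult_support[OF assms]]) (use fin in auto)
  ultimately show ?thesis by (simp add: CFM_def)
qed

lemma CFM_add_closed:
  assumes "A \<in> carrier (CFM R)" "B \<in> carrier (CFM R)"
  shows "A \<oplus>\<^bsub>CFM R\<^esub> B \<in> carrier (CFM R)"
proof -
  have "finite {i. A i j \<oplus> B i j \<noteq> \<zero>}" for j
    by (rule finite_subset[of _ "{i. A i j \<noteq> \<zero>} \<union> {i. B i j \<noteq> \<zero>}"])
      (use assms in \<open>auto simp: CFM_def\<close>)
  then show ?thesis using assms by (auto simp: CFM_def)
qed

lemma CFM_minus_closed: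
  assumes "A \<in> carrier (CFM R)"
  shows "(\<lambda>i j. \<ominus> A i j) \<in> carrier (CFM R)"
proof -
  have "finite {i. \<ominus> A i j \<noteq> \<zero>}" for j
    by (rule finite_subset[of _ "{i. A i j \<noteq> \<zero>}"]) (use assms in \<open>auto simp: CFM_def\<close>)
  then show ?thesis using assms by (auto simp: CFM_def)
qed

lemma CFM_one_closed: "\<one>\<^bsub>CFM R\<^esub> \<in> carrier (CFM R)"
proof -
  have "finite {i. (if i = j then \<one> else \<zero>) \<noteq> \<zero>}" for j :: nat
    by (rule finite_subset[of _ "{j}"]) auto
  then show ?thesis by (auto simp: CFM_def)
qed

lemma CFM_assoc:
  assumes "A \<in> carrier (CFM R)" "B \<in> carrier (CFM R)" "C \<in> carrier (CFM R)"
  shows "(A \<otimes>\<^bsub>CFM R\<^esub> B) \<otimes>\<^bsub>CFM R\<^esub> C = A \<otimes>\<^bsub>CFM R\<^esub> (B \<otimes>\<^bsub>CFM R\<^esub> C)"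
proof (intro ext)
  fix i j
  have *: "\<And>i j. A i j \<in> carrier R" "\<And>i j. B i j \<in> carrier R" "\<And>i j. C i j \<in> carrier R"
    and fin: "\<And>j. finite {i. B i j \<noteq> \<zero>}" "\<And>j. finite {i. C i j \<noteq> \<zero>}"
    using assms by (auto simp: CFM_def)
  define L where "L = {l. C l j \<noteq> \<zero>}"
  define K where "K = (\<Union>l\<in>L. {k. B k l \<noteq> \<zero>})"
  have finL: "finite L" and finK: "finite K" using fin by (auto simp: L_def K_def)
  have supp: "{k. (B \<otimes>\<^bsub>CFM R\<^esub> C) k j \<noteq> \<zero>} \<subseteq> K"
    unfolding K_def L_def by (rule CFM_mult_support[OF assms(2,3)])
  have "((A \<otimes>\<^bsub>CFM R\<^esub> B) \<otimes>\<^bsub>CFM R\<^esub> C) i j = (\<Oplus>l\<in>L. (A \<otimes>\<^bsub>CFM R\<^esub> B) i l \<otimes> C l j)"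
    by (rule CFM_mult_eq[OF CFM_mult_closed[OF assms(1,2)] assms(3) finL]) (simp add: L_def)
  also have "\<dots> = (\<Oplus>l\<in>L. \<Oplus>k\<in>K. A i k \<otimes> (B k l \<otimes> C l j))"
  proof (rule finsum_cong')
    fix l assume l: "l \<in> L"
    have "(A \<otimes>\<^bsub>CFM R\<^esub> B) i l = (\<Oplus>k\<in>K. A i k \<otimes> B k l)"
      by (rule CFM_mult_eq[OF assms(1,2) finK]) (use l in \<open>auto simp: K_def\<close>)
    then show "(A \<otimes>\<^bsub>CFM R\<^esub> B) i l \<otimes> C l j = (\<Oplus>k\<in>K. A i k \<otimes> (B k l \<otimes> C l j))"
      using * finK by (simp add: finsum_ldistr m_assoc Pi_def)
  qed (use * in auto)
  also have "\<dots> = (\<Oplus>k\<in>K. \<Oplus>l\<in>L. A i k \<otimes> (B k l \<otimes> C l j))"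
    using * finK finL by (intro finsum_swap) auto
  also have "\<dots> = (\<Oplus>k\<in>K. A i k \<otimes> (B \<otimes>\<^bsub>CFM R\<^esub> C) k j)"
  proof (rule finsum_cong')
    fix k
    have "(B \<otimes>\<^bsub>CFM R\<^esub> C) k j = (\<Oplus>l\<in>L. B k l \<otimes> C l j)"
      by (rule CFM_mult_eq[OF assms(2,3) finL]) (simp add: L_def)
    then show "(\<Oplus>l\<in>L. A i k \<otimes> (B k l \<otimes> C l j)) = A i k \<otimes> (B \<otimes>\<^bsub>CFM R\<^esub> C) k j"
      using * finL by (simp add: finsum_rdistr Pi_def)
  qed (use * CFM_mult_closed[OF assms(2,3)] in \<open>auto simp: CFM_def\<close>)
  also have "\<dots> = (A \<otimes>\<^bsub>CFM R\<^esub> (B \<otimes>\<^bsub>CFM R\<^esub> C)) i j"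
    by (rule CFM_mult_eq[OF assms(1) CFM_mult_closed[OF assms(2,3)] finK supp, symmetric])
  finally show "((A \<otimes>\<^bsub>CFM R\<^esub> B) \<otimes>\<^bsub>CFM R\<^esub> C) i j = (A \<otimes>\<^bsub>CFM R\<^esub> (B \<otimes>\<^bsub>CFM R\<^esub> C)) i j" .
qed

lemma CFM_l_one:
  assumes "A \<in> carrier (CFM R)"
  shows "\<one>\<^bsub>CFM R\<^esub> \<otimes>\<^bsub>CFM R\<^esub> A = A"
proof (intro ext)
  fix i j
  have *: "\<And>i j. A i j \<in> carrier R" and fin: "finite {k. A k j \<noteq> \<zero>}"
    using assms by (auto simp: CFM_def)
  have "(\<one>\<^bsub>CFM R\<^esub> \<otimes>\<^bsub>CFM R\<^esub> A) i j
      = (\<Oplus>k\<in>insert i {k. A k j \<noteq> \<zero>}. \<one>\<^bsub>CFM R\<^esub> i k \<otimes> A k j)"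
    by (rule CFM_mult_eq[OF CFM_one_closed assms]) (use fin in auto)
  also have "\<dots> = (\<Oplus>k\<in>insert i {k. A k j \<noteq> \<zero>}. if i = k then A k j else \<zero>)"
    using * by (intro finsum_cong') (auto simp: CFM_def)
  also have "\<dots> = A i j"
    using * fin by (intro finsum_singleton) auto
  finally show "(\<one>\<^bsub>CFM R\<^esub> \<otimes>\<^bsub>CFM R\<^esub> A) i j = A i j" .
qed

lemma CFM_r_one:
  assumes "A \<in> carrier (CFM R)"
  shows "A \<otimes>\<^bsub>CFM R\<^esub> \<one>\<^bsub>CFM R\<^esub> = A"
proof (intro ext)
  fix i j
  have *: "\<And>i j. A i j \<in> carrier R"
    using assms by (auto simp: CFM_def)
  have "(A \<otimes>\<^bsub>CFM R\<^esub> \<one>\<^bsub>CFM R\<^esub>) i j = (\<Oplus>k\<in>{j}. A i k \<otimes> \<one>\<^bsub>CFM R\<^esub> k j)"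
    by (rule CFM_mult_eq[OF assms CFM_one_closed]) (auto simp: CFM_def)
  also have "\<dots> = A i j" using * by (simp add: CFM_def)
  finally show "(A \<otimes>\<^bsub>CFM R\<^esub> \<one>\<^bsub>CFM R\<^esub>) i j = A i j" .
qed

lemma CFM_l_distr:
  assumes "A \<in> carrier (CFM R)" "B \<in> carrier (CFM R)" "C \<in> carrier (CFM R)"
  shows "(A \<oplus>\<^bsub>CFM R\<^esub> B) \<otimes>\<^bsub>CFM R\<^esub> C
    = (A \<otimes>\<^bsub>CFM R\<^esub> C) \<oplus>\<^bsub>CFM R\<^esub> (B \<otimes>\<^bsub>CFM R\<^esub> C)"
proof (intro ext)
  fix i j
  have *: "\<And>i j. A i j \<in> carrier R" "\<And>i j. B i j \<in> carrier R" "\<And>i j. C i j \<in> carrier R"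
    using assms by (auto simp: CFM_def)
  have "(\<Oplus>k\<in>{k. C k j \<noteq> \<zero>}. (A i k \<oplus> B i k) \<otimes> C k j)
      = (\<Oplus>k\<in>{k. C k j \<noteq> \<zero>}. A i k \<otimes> C k j \<oplus> B i k \<otimes> C k j)"
    using * by (intro finsum_cong') (auto simp: l_distr)
  also have "\<dots> = (\<Oplus>k\<in>{k. C k j \<noteq> \<zero>}. A i k \<otimes> C k j) \<oplus> (\<Oplus>k\<in>{k. C k j \<noteq> \<zero>}. B i k \<otimes> C k j)"
    using * by (intro finsum_addf) auto
  finally show "((A \<oplus>\<^bsub>CFM R\<^esub> B) \<otimes>\<^bsub>CFM R\<^esub> C) i j
      = ((A \<otimes>\<^bsub>CFM R\<^esub> C) \<oplus>\<^bsub>CFM R\<^esub> (B \<otimes>\<^bsub>CFM R\<^esub> C)) i j"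
    by (simp add: CFM_def)
qed

lemma CFM_r_distr:
  assumes "A \<in> carrier (CFM R)" "B \<in> carrier (CFM R)" "C \<in> carrier (CFM R)"
  shows "C \<otimes>\<^bsub>CFM R\<^esub> (A \<oplus>\<^bsub>CFM R\<^esub> B)
    = (C \<otimes>\<^bsub>CFM R\<^esub> A) \<oplus>\<^bsub>CFM R\<^esub> (C \<otimes>\<^bsub>CFM R\<^esub> B)"
proof (intro ext)
  fix i j
  have *: "\<And>i j. A i j \<in> carrier R" "\<And>i j. B i j \<in> carrier R" "\<And>i j. C i j \<in> carrier R"
    and fin: "finite {k. A k j \<noteq> \<zero>}" "finite {k. B k j \<noteq> \<zero>}"
    using assms by (auto simp: CFM_def)
  define K where "K = {k. A k j \<noteq> \<zero>} \<union> {k. B k j \<noteq> \<zero>}"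
  have finK: "finite K" using fin by (simp add: K_def)
  have add: "(X \<oplus>\<^bsub>CFM R\<^esub> Y) i j = X i j \<oplus> Y i j" for X Y i j
    by (simp add: CFM_def)
  have "(C \<otimes>\<^bsub>CFM R\<^esub> (A \<oplus>\<^bsub>CFM R\<^esub> B)) i j
      = (\<Oplus>k\<in>K. C i k \<otimes> (A \<oplus>\<^bsub>CFM R\<^esub> B) k j)"
    by (rule CFM_mult_eq[OF assms(3) CFM_add_closed[OF assms(1,2)] finK])
      (use * in \<open>auto simp: K_def add\<close>)
  also have "\<dots> = (\<Oplus>k\<in>K. C i k \<otimes> A k j \<oplus> C i k \<otimes> B k j)"
    using * by (intro finsum_cong') (auto simp: r_distr add)
  also have "\<dots> = (\<Oplus>k\<in>K. C i k \<otimes> A k j) \<oplus> (\<Oplus>k\<in>K. C i k \<otimes> B k j)"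
    using * by (intro finsum_addf) auto
  also have "(\<Oplus>k\<in>K. C i k \<otimes> A k j) = (C \<otimes>\<^bsub>CFM R\<^esub> A) i j"
    by (rule CFM_mult_eq[OF assms(3,1) finK, symmetric]) (simp add: K_def)
  also have "(\<Oplus>k\<in>K. C i k \<otimes> B k j) = (C \<otimes>\<^bsub>CFM R\<^esub> B) i j"
    by (rule CFM_mult_eq[OF assms(3,2) finK, symmetric]) (simp add: K_def)
  finally show "(C \<otimes>\<^bsub>CFM R\<^esub> (A \<oplus>\<^bsub>CFM R\<^esub> B)) i j
      = ((C \<otimes>\<^bsub>CFM R\<^esub> A) \<oplus>\<^bsub>CFM R\<^esub> (C \<otimes>\<^bsub>CFM R\<^esub> B)) i j"
    unfolding add[of "C \<otimes>\<^bsub>CFM R\<^esub> A" "C \<otimes>\<^bsub>CFM R\<^esub> B" i j] .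
qed

lemma ring_CFM: "ring (CFM R)"
proof (rule ringI)
  show "abelian_group (CFM R)"
  proof (rule abelian_groupI)
    fix A assume A: "A \<in> carrier (CFM R)"
    show "\<exists>B \<in> carrier (CFM R). B \<oplus>\<^bsub>CFM R\<^esub> A = \<zero>\<^bsub>CFM R\<^esub>"
      by (rule bexI[OF _ CFM_minus_closed[OF A]])
        (use A in \<open>auto simp: CFM_def l_neg intro!: ext\<close>)
  qed (simp add: CFM_add_closed, auto simp: CFM_def a_assoc intro!: ext a_comm)
  show "Group.monoid (CFM R)"
    by (rule monoidI) (simp_all add: CFM_mult_closed CFM_one_closed CFM_assoc CFM_l_one CFM_r_one)
qed (simp_all add: CFM_l_distr CFM_r_distr)

lemma CFM_a_inv:
  assumes "A \<in> carrier (CFM R)"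
  shows "\<ominus>\<^bsub>CFM R\<^esub> A = (\<lambda>i j. \<ominus> A i j)"
proof -
  interpret C: ring "CFM R" by (rule ring_CFM)
  show ?thesis
    by (rule C.minus_equality[OF _ assms CFM_minus_closed[OF assms]])
      (use assms in \<open>auto simp: CFM_def l_neg intro!: ext\<close>)
qed

lemma subring_LTDFM: "subring (carrier (LTDFM R)) (CFM R)"
proof -
  interpret C: ring "CFM R" by (rule ring_CFM)
  have mem: "A \<in> carrier (LTDFM R) \<longleftrightarrow>
      A \<in> carrier (CFM R) \<and> lower_triangular R A \<and> diagonal_finite R A" for A
    by (simp add: LTDFM_def)
  show ?thesis
  proof (rule C.subringI)
    show "carrier (LTDFM R) \<subseteq> carrier (CFM R)" using mem by blast
    show "\<one>\<^bsub>CFM R\<^esub> \<in> carrier (LTDFM R)"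
      unfolding mem lower_triangular_def diagonal_finite_def
      by (auto simp: CFM_one_closed) (auto simp: CFM_def)
  next
    fix A assume "A \<in> carrier (LTDFM R)"
    then show "\<ominus>\<^bsub>CFM R\<^esub> A \<in> carrier (LTDFM R)"
      unfolding mem using C.a_inv_closed[of A]
      by (auto simp: CFM_a_inv lower_triangular_def diagonal_finite_def)
  next
    fix A B assume AB: "A \<in> carrier (LTDFM R)" "B \<in> carrier (LTDFM R)"
    have cfm: "A \<in> carrier (CFM R)" "B \<in> carrier (CFM R)"
      and lt: "\<And>i j. i < j \<Longrightarrow> A i j = \<zero>" "\<And>i j. i < j \<Longrightarrow> B i j = \<zero>"
      using AB by (auto simp: mem lower_triangular_def)
    obtain m n where m: "m > 0" "\<And>i j. i \<ge> j + m \<Longrightarrow> A i j = \<zero>"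
      and n: "n > 0" "\<And>i j. i \<ge> j + n \<Longrightarrow> B i j = \<zero>"
      using AB unfolding mem diagonal_finite_def by metis
    have nz: "\<exists>k. A i k \<noteq> \<zero> \<and> B k j \<noteq> \<zero>" if "(A \<otimes>\<^bsub>CFM R\<^esub> B) i j \<noteq> \<zero>" for i j
      using CFM_mult_support[OF cfm, of j] that by blast
    have "(A \<otimes>\<^bsub>CFM R\<^esub> B) i j = \<zero>" if "i < j" for i j
      using nz[of i j] lt that by (metis linorder_neqE_nat order.strict_trans)
    moreover have "(A \<otimes>\<^bsub>CFM R\<^esub> B) i j = \<zero>" if "i \<ge> j + (m + n)" for i j
    proof (rule ccontr)
      assume "\<not> ?thesis"
      then obtain k where "A i k \<noteq> \<zero>" "B k j \<noteq> \<zero>" using nz by blast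
      then have "i < k + m" "k < j + n" using m(2) n(2) by (meson not_le)+
      then show False using that by linarith
    qed
    ultimately show "A \<otimes>\<^bsub>CFM R\<^esub> B \<in> carrier (LTDFM R)"
      using CFM_mult_closed[OF cfm] m(1) unfolding mem lower_triangular_def diagonal_finite_def
      by (metis add_gr_0)
    have add: "(A \<oplus>\<^bsub>CFM R\<^esub> B) i j = A i j \<oplus> B i j" for i j
      by (simp add: CFM_def)
    have "\<forall>j. \<forall>i \<ge> j + (m + n). (A \<oplus>\<^bsub>CFM R\<^esub> B) i j = \<zero>"
      using m(2) n(2) by (simp add: add)
    then show "A \<oplus>\<^bsub>CFM R\<^esub> B \<in> carrier (LTDFM R)"
      using CFM_add_closed[OF cfm] m(1) lt unfolding mem lower_triangular_def diagonal_finite_def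
      by (auto simp: add intro!: exI[of _ "m + n"])
  qed
qed

lemma ring_LTDFM: "ring (LTDFM R)"
proof -
  interpret C: ring "CFM R" by (rule ring_CFM)
  have "LTDFM R = (CFM R)\<lparr>carrier := carrier (LTDFM R)\<rparr>"
    by (simp add: LTDFM_def)
  then show ?thesis using C.subring_is_ring[OF subring_LTDFM] by simp
qed

end

end

theory Submission
  imports Defs
begin

text \<open>
  An invertible diagonal plus a strictly lower triangular banded matrix need not be a unit: the
  inverse of \<open>1 - S\<close>, with \<open>S\<close> the shift, has infinitely many nonzero diagonals.  The nilpotent
  summand is there to cut such a matrix into finite blocks of bounded size.

  Let \<open>A\<close> have all its nonzero entries on the first \<open>n\<close> diagonals, and cut the indices into
  intervals of length \<open>m = 2n\<close>.  The part \<open>N\<close> of \<open>A\<close> that joins different intervals consists of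
  jumps of length less than \<open>n\<close>; two consecutive jumps move an index by less than \<open>m\<close>, so they
  cannot pass over a whole interval, and hence \<open>N\<^sup>2 = 0\<close>.  What remains is block diagonal.  A clean
  decomposition \<open>u\<^sub>i + e\<^sub>i\<close> of each diagonal entry yields the idempotent \<open>E = diag(e\<^sub>i)\<close> and the
  unit \<open>D = diag(u\<^sub>i)\<close>, and with \<open>M\<close> the part of \<open>A\<close> strictly below the diagonal inside the
  blocks, \<open>D + M = D (1 + X)\<close> where \<open>X = D\<^sup>-\<^sup>1 M\<close>.  A chain of descents inside an interval has
  fewer than \<open>m\<close> steps, so \<open>X\<^sup>m = 0\<close>, and \<open>D (1 + X)\<close> is a unit whose inverse is again banded.
  Thus \<open>A = N + E + D (1 + X)\<close>.

  Both nilpotency claims are instances of lemma \<open>LTDFM_nilpotentI\<close>: a matrix is nilpotent if the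
  directed graph of its nonzero entries has no path of some fixed length.
\<close>

context ring
begin

section \<open>Units from nilpotent elements\<close>

text \<open>
  The inverse is the finite geometric sum; the element \<open>y\<close> of the induction is its partial sum.
\<close>

lemma one_minus_nilpotent_Units:
  assumes "x \<in> nilpotents R"
  shows "\<one> \<ominus> x \<in> Units R"
proof -
  obtain k :: nat where x: "x \<in> carrier R" and k: "x [^] k = \<zero>"
    using assms by (auto simp: nilpotents_def)
  have "\<exists>y \<in> carrier R. (\<one> \<ominus> x) \<otimes> y = \<one> \<ominus> x [^] j \<and> y \<otimes> (\<one> \<ominus> x) = \<one> \<ominus> x [^] j" for j :: nat
  proof (induction j)
    case 0
    show ?case using x by (intro bexI[of _ \<zero>]) (auto simp: minus_eq r_neg)
  next
    case (Suc j)
    then obtain y where y: "y \<in> carrier R"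
      and l: "(\<one> \<ominus> x) \<otimes> y = \<one> \<ominus> x [^] j" and r: "y \<otimes> (\<one> \<ominus> x) = \<one> \<ominus> x [^] j"
      by blast
    have telescope: "(\<one> \<ominus> x [^] j) \<oplus> (x [^] j \<ominus> x [^] Suc j) = \<one> \<ominus> x [^] Suc j"
      using x by (simp add: minus_eq a_assoc r_neg1 l_neg del: nat_pow_Suc)
    have "(\<one> \<ominus> x) \<otimes> (y \<oplus> x [^] j) = \<one> \<ominus> x [^] Suc j"
    proof -
      have "(\<one> \<ominus> x) \<otimes> (y \<oplus> x [^] j) = (\<one> \<ominus> x) \<otimes> y \<oplus> (\<one> \<ominus> x) \<otimes> x [^] j"
        using x y by (simp add: r_distr)
      also have "(\<one> \<ominus> x) \<otimes> x [^] j = x [^] j \<ominus> x [^] Suc j"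
        unfolding nat_pow_Suc2[OF x] using x by (simp add: minus_eq l_distr l_minus)
      finally show ?thesis using l telescope by simp
    qed
    moreover have "(y \<oplus> x [^] j) \<otimes> (\<one> \<ominus> x) = \<one> \<ominus> x [^] Suc j"
    proof -
      have "(y \<oplus> x [^] j) \<otimes> (\<one> \<ominus> x) = y \<otimes> (\<one> \<ominus> x) \<oplus> x [^] j \<otimes> (\<one> \<ominus> x)"
        using x y by (simp add: l_distr)
      also have "x [^] j \<otimes> (\<one> \<ominus> x) = x [^] j \<ominus> x [^] Suc j"
        using x by (simp add: minus_eq r_distr r_minus)
      finally show ?thesis using r telescope by simp
    qed
    ultimately show ?case using x y by (intro bexI[of _ "y \<oplus> x [^] j"]) auto
  qed
  from this[of k] show ?thesis
    using x k by (auto simp: Units_def minus_eq)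
qed

lemma nilpotents_minus:
  assumes "x \<in> nilpotents R"
  shows "\<ominus> x \<in> nilpotents R"
proof -
  obtain k :: nat where x: "x \<in> carrier R" and k: "k > 0" "x [^] k = \<zero>"
    using assms by (auto simp: nilpotents_def)
  have "(\<ominus> x) [^] j \<in> {x [^] j, \<ominus> (x [^] j)}" for j :: nat
    using x by (induction j) (auto simp: l_minus r_minus)
  from this[of k] show ?thesis
    using x k by (auto simp: nilpotents_def)
qed

lemma one_plus_nilpotent_Units:
  assumes "x \<in> nilpotents R"
  shows "\<one> \<oplus> x \<in> Units R"
  using one_minus_nilpotent_Units[OF nilpotents_minus[OF assms]] assms
  by (simp add: minus_eq nilpotents_def)

section \<open>Nilpotent banded matrices\<close>

lemma LTDFM_simps:
  "mult (LTDFM R) = mult (CFM R)"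
  "\<zero>\<^bsub>LTDFM R\<^esub> = (\<lambda>i j. \<zero>)"
  "\<one>\<^bsub>LTDFM R\<^esub> = (\<lambda>i j. if i = j then \<one> else \<zero>)"
  "A \<oplus>\<^bsub>LTDFM R\<^esub> B = (\<lambda>i j. A i j \<oplus> B i j)"
  by (auto simp: LTDFM_def CFM_def)

lemma LTDFM_carrierI:
  assumes "\<And>i j. A i j \<in> carrier R"
    and "\<And>i j. A i j \<noteq> \<zero> \<Longrightarrow> j \<le> i \<and> i < j + n"
  shows "A \<in> carrier (LTDFM R)"
proof -
  have "{i. A i j \<noteq> \<zero>} \<subseteq> {..<j + n}" for j
    using assms(2) by auto
  then have "finite {i. A i j \<noteq> \<zero>}" for j
    using finite_subset by blast
  moreover have "lower_triangular R A"
    unfolding lower_triangular_def using assms(2) by (meson not_le)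
  moreover have "diagonal_finite R A"
    unfolding diagonal_finite_def
  proof (intro exI[of _ "Suc n"] conjI allI impI)
    fix i j assume "j + Suc n \<le> i"
    then show "A i j = \<zero>" using assms(2)[of i j] by linarith
  qed simp
  ultimately show ?thesis
    using assms(1) by (simp add: LTDFM_def CFM_def)
qed

lemma LTDFM_carrierD:
  assumes "A \<in> carrier (LTDFM R)"
  shows "A \<in> carrier (CFM R)" "A i j \<in> carrier R"
  using assms by (auto simp: LTDFM_def CFM_def)

lemma LTDFM_bandE:
  assumes "A \<in> carrier (LTDFM R)"
  obtains n where "n > 0" "\<And>i j. A i j \<noteq> \<zero> \<Longrightarrow> j \<le> i \<and> i < j + n"
  using assms unfolding LTDFM_def lower_triangular_def diagonal_finite_def
  by simp (metis not_le)

text \<open>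
  A nonzero entry of a power forces a path in the graph whose edges are the positions of the
  nonzero entries.
\<close>

lemma LTDFM_pow_support:
  assumes A: "A \<in> carrier (LTDFM R)" and "(A [^]\<^bsub>LTDFM R\<^esub> k) i j \<noteq> \<zero>"
  shows "((\<lambda>i j. A i j \<noteq> \<zero>) ^^ k) i j"
  using assms(2)
proof (induction k arbitrary: j)
  case 0
  then show ?case by (auto simp: nat_pow_def LTDFM_simps split: if_splits)
next
  case (Suc k)
  interpret L: ring "LTDFM R" by (rule ring_LTDFM)
  have "A [^]\<^bsub>LTDFM R\<^esub> k \<in> carrier (CFM R)"
    using A by (intro LTDFM_carrierD(1)) simp
  from CFM_mult_support[OF this LTDFM_carrierD(1)[OF A], of j] Suc.prems
  obtain l where "(A [^]\<^bsub>LTDFM R\<^esub> k) i l \<noteq> \<zero>" "A l j \<noteq> \<zero>"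
    by (auto simp: LTDFM_simps)
  with Suc.IH show ?case by (intro relpowp_Suc_I) auto
qed

lemma LTDFM_nilpotentI:
  assumes "A \<in> carrier (LTDFM R)" "k > 0"
    and "\<And>i j. \<not> ((\<lambda>i j. A i j \<noteq> \<zero>) ^^ k) i j"
  shows "A \<in> nilpotents (LTDFM R)"
proof -
  have "A [^]\<^bsub>LTDFM R\<^esub> k = \<zero>\<^bsub>LTDFM R\<^esub>"
    unfolding LTDFM_simps
  proof (intro ext)
    show "(A [^]\<^bsub>LTDFM R\<^esub> k) i j = \<zero>" for i j
      using LTDFM_pow_support[OF assms(1), of k i j] assms(3)[of i j] by blast
  qed
  then show ?thesis using assms by (auto simp: nilpotents_def)
qed

section \<open>Diagonal matrices\<close>

definition diag :: "(nat \<Rightarrow> 'a) \<Rightarrow> nat \<Rightarrow> nat \<Rightarrow> 'a" where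
  "diag d = (\<lambda>i j. if i = j then d i else \<zero>)"

lemma diag_closed:
  assumes "\<And>i. d i \<in> carrier R"
  shows "diag d \<in> carrier (LTDFM R)"
  using assms by (intro LTDFM_carrierI[of _ 1]) (auto simp: diag_def split: if_splits)

lemma diag_mult:
  assumes "\<And>i. d i \<in> carrier R" "A \<in> carrier (LTDFM R)"
  shows "diag d \<otimes>\<^bsub>LTDFM R\<^esub> A = (\<lambda>i j. d i \<otimes> A i j)"
proof (intro ext)
  fix i j
  note A = LTDFM_carrierD[OF assms(2)]
  have fin: "finite (insert i {k. A k j \<noteq> \<zero>})"
    using A(1) by (simp add: CFM_def)
  have "(diag d \<otimes>\<^bsub>LTDFM R\<^esub> A) i j = (\<Oplus>k\<in>insert i {k. A k j \<noteq> \<zero>}. diag d i k \<otimes> A k j)"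
    unfolding LTDFM_simps
    by (rule CFM_mult_eq[OF LTDFM_carrierD(1)[OF diag_closed[OF assms(1)]] A(1) fin]) auto
  also have "\<dots> = (\<Oplus>k\<in>insert i {k. A k j \<noteq> \<zero>}. if i = k then d k \<otimes> A k j else \<zero>)"
    using A(2) assms(1) by (intro finsum_cong') (auto simp: diag_def)
  also have "\<dots> = d i \<otimes> A i j"
    using A(2) assms(1) fin by (intro finsum_singleton) auto
  finally show "(diag d \<otimes>\<^bsub>LTDFM R\<^esub> A) i j = d i \<otimes> A i j" .
qed

lemma diag_mult_diag:
  assumes "\<And>i. c i \<in> carrier R" "\<And>i. d i \<in> carrier R"
  shows "diag c \<otimes>\<^bsub>LTDFM R\<^esub> diag d = diag (\<lambda>i. c i \<otimes> d i)"
  using assms by (simp add: diag_mult diag_closed) (auto simp: diag_def intro!: ext)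

lemma diag_Units:
  assumes "\<And>i. u i \<in> Units R"
  shows "diag u \<in> Units (LTDFM R)"
proof -
  have uc: "u i \<in> carrier R" "inv u i \<in> carrier R" for i
    using assms by auto
  have "\<one>\<^bsub>LTDFM R\<^esub> = diag (\<lambda>i. \<one>)"
    by (simp add: LTDFM_simps diag_def)
  then have "diag u \<otimes>\<^bsub>LTDFM R\<^esub> diag (\<lambda>i. inv u i) = \<one>\<^bsub>LTDFM R\<^esub>"
    "diag (\<lambda>i. inv u i) \<otimes>\<^bsub>LTDFM R\<^esub> diag u = \<one>\<^bsub>LTDFM R\<^esub>"
    using assms by (simp_all add: diag_mult_diag uc)
  moreover have "diag u \<in> carrier (LTDFM R)" "diag (\<lambda>i. inv u i) \<in> carrier (LTDFM R)"
    by (simp_all add: diag_closed uc)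
  ultimately show ?thesis unfolding Units_def by blast
qed

lemma diag_idempotent:
  assumes "\<And>i. e i \<in> idempotents R"
  shows "diag e \<in> idempotents (LTDFM R)"
  using assms by (simp add: idempotents_def diag_mult_diag diag_closed)

section \<open>Cutting the indices into intervals\<close>

text \<open>
  A path descends by at least one at each step while staying inside one interval of length \<open>m\<close>.
\<close>

lemma block_part_nilpotent:
  assumes A: "A \<in> carrier (LTDFM R)" and m: "m > 0"
    and supp: "\<And>i j. A i j \<noteq> \<zero> \<Longrightarrow> j < i \<and> i div m = j div m"
  shows "A \<in> nilpotents (LTDFM R)"
proof (rule LTDFM_nilpotentI[OF A m])
  fix i j
  have path: "((\<lambda>i j. A i j \<noteq> \<zero>) ^^ k) i j \<Longrightarrow> j + k \<le> i \<and> i div m = j div m" for k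
  proof (induction k arbitrary: j)
    case (Suc k)
    then obtain l where "((\<lambda>i j. A i j \<noteq> \<zero>) ^^ k) i l" "A l j \<noteq> \<zero>"
      by (blast elim: relpowp_Suc_E)
    with Suc.IH[of l] supp[of l j] show ?case by auto
  qed auto
  show "\<not> ((\<lambda>i j. A i j \<noteq> \<zero>) ^^ m) i j"
  proof
    assume "((\<lambda>i j. A i j \<noteq> \<zero>) ^^ m) i j"
    with path have "j + m \<le> i" "i div m = j div m" by auto
    moreover have "(j + m) div m = Suc (j div m)" using m by simp
    ultimately show False by (metis div_le_mono Suc_n_not_le_n)
  qed
qed

text \<open>
  Two edges in a row would pass through three intervals, hence descend by more than the length
  \<open>2 * n\<close> of the middle one, but each edge descends by less than \<open>n\<close>.
\<close>

lemma off_block_part_nilpotent: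
  assumes A: "A \<in> carrier (LTDFM R)"
    and supp: "\<And>i j. A i j \<noteq> \<zero> \<Longrightarrow> j \<le> i \<and> i < j + n \<and> i div (2 * n) \<noteq> j div (2 * n)"
  shows "A \<in> nilpotents (LTDFM R)"
proof (rule LTDFM_nilpotentI[OF A, of 2])
  fix i j
  show "\<not> ((\<lambda>i j. A i j \<noteq> \<zero>) ^^ 2) i j"
  proof
    assume "((\<lambda>i j. A i j \<noteq> \<zero>) ^^ 2) i j"
    then obtain k where "A i k \<noteq> \<zero>" "A k j \<noteq> \<zero>"
      by (auto simp: numeral_2_eq_2)
    note s = supp[OF this(1)] supp[OF this(2)]
    then have "n > 0" by (cases n) auto
    have "j div (2 * n) < k div (2 * n)" "k div (2 * n) < i div (2 * n)"
      using s div_le_mono[of j k "2 * n"] div_le_mono[of k i "2 * n"] by linarith+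
    moreover have "i div (2 * n) \<le> (j + 2 * n) div (2 * n)"
      using s by (intro div_le_mono) linarith
    moreover have "(j + 2 * n) div (2 * n) = Suc (j div (2 * n))"
      using \<open>n > 0\<close> by simp
    ultimately show False by linarith
  qed
qed simp

end

section \<open>Clean coefficients give nil-good clean banded matrices\<close>

theorem proposition5p6:
  fixes R :: "('a, 'm) ring_scheme"
  assumes "clean_ring R"
  shows "nil_good_clean_ring (LTDFM R)"
proof -
  interpret ring R using assms by (simp add: clean_ring_def)
  interpret L: ring "LTDFM R" by (rule ring_LTDFM)
  have "\<exists>N \<in> nilpotents (LTDFM R). \<exists>E \<in> idempotents (LTDFM R). \<exists>U \<in> Units (LTDFM R).
      A = N \<oplus>\<^bsub>LTDFM R\<^esub> E \<oplus>\<^bsub>LTDFM R\<^esub> U" if A: "A \<in> carrier (LTDFM R)" for A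
  proof -
    note Ac = LTDFM_carrierD(2)[OF A]
    obtain n where n: "n > 0" and band: "\<And>i j. A i j \<noteq> \<zero>\<^bsub>R\<^esub> \<Longrightarrow> j \<le> i \<and> i < j + n"
      using LTDFM_bandE[OF A] by blast
    have "\<forall>i. \<exists>u e. u \<in> Units R \<and> e \<in> idempotents R \<and> A i i = u \<oplus>\<^bsub>R\<^esub> e"
      using assms Ac unfolding clean_ring_def by blast
    then obtain u e where u: "\<And>i. u i \<in> Units R" and e: "\<And>i. e i \<in> idempotents R"
      and clean: "\<And>i. A i i = u i \<oplus>\<^bsub>R\<^esub> e i"
      by metis
    have ec: "e i \<in> carrier R" for i
      using e by (simp add: idempotents_def)
    define m where "m = 2 * n"
    define N where "N = (\<lambda>i j. if i div m = j div m then \<zero>\<^bsub>R\<^esub> else A i j)"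
    define X where "X = (\<lambda>i j. if j < i \<and> i div m = j div m
      then inv\<^bsub>R\<^esub> (u i) \<otimes>\<^bsub>R\<^esub> A i j else \<zero>\<^bsub>R\<^esub>)"
    have Xsupp: "X i j \<noteq> \<zero>\<^bsub>R\<^esub> \<Longrightarrow> j < i \<and> i < j + n \<and> i div m = j div m" for i j
      using band[of i j] u[of i]
      by (cases "A i j = \<zero>\<^bsub>R\<^esub>") (auto simp: X_def split: if_splits)
    have Nc: "N \<in> carrier (LTDFM R)"
      using Ac band by (intro LTDFM_carrierI[of _ n]) (auto simp: N_def split: if_splits)
    have Xc: "X \<in> carrier (LTDFM R)"
    proof (rule LTDFM_carrierI[of _ n])
      show "X i j \<in> carrier R" for i j using Ac u by (simp add: X_def)
      show "X i j \<noteq> \<zero>\<^bsub>R\<^esub> \<Longrightarrow> j \<le> i \<and> i < j + n" for i j using Xsupp[of i j] by simp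
    qed
    have Nnil: "N \<in> nilpotents (LTDFM R)"
      by (rule off_block_part_nilpotent[OF Nc, of n])
        (use band in \<open>auto simp: N_def m_def split: if_splits\<close>)
    have Xnil: "X \<in> nilpotents (LTDFM R)"
      by (rule block_part_nilpotent[OF Xc, of m]) (use n Xsupp in \<open>auto simp: m_def\<close>)
    \<comment> \<open>Factoring out the diagonal \<open>u\<close> is what puts the inverses of the \<open>u\<^sub>i\<close> into \<open>X\<close>: the product
      restores the entries of \<open>A\<close> below the diagonal inside the blocks.\<close>
    define U where "U = diag u \<otimes>\<^bsub>LTDFM R\<^esub> (\<one>\<^bsub>LTDFM R\<^esub> \<oplus>\<^bsub>LTDFM R\<^esub> X)"
    have Uunit: "U \<in> Units (LTDFM R)"
      unfolding U_def by (intro L.Units_m_closed diag_Units u L.one_plus_nilpotent_Units Xnil)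
    have U_eq: "U = (\<lambda>i j. u i \<otimes>\<^bsub>R\<^esub> (\<one>\<^bsub>LTDFM R\<^esub> \<oplus>\<^bsub>LTDFM R\<^esub> X) i j)"
      unfolding U_def using u Xc by (intro diag_mult) auto
    have "A i j = (N \<oplus>\<^bsub>LTDFM R\<^esub> diag e \<oplus>\<^bsub>LTDFM R\<^esub> U) i j" for i j
    proof (cases i j rule: linorder_cases)
      case less
      then have "A i j = \<zero>\<^bsub>R\<^esub>" using band[of i j] by auto
      with less Units_closed[OF u[of i]] show ?thesis
        by (simp add: U_eq LTDFM_simps N_def X_def diag_def)
    next
      case equal
      then show ?thesis using Units_closed[OF u[of i]] ec[of i] clean[of i]
        by (simp add: U_eq LTDFM_simps N_def X_def diag_def a_comm)
    next
      case greater
      have "u i \<otimes>\<^bsub>R\<^esub> (inv\<^bsub>R\<^esub> (u i) \<otimes>\<^bsub>R\<^esub> A i j) = A i j"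
        using u[of i] Ac[of i j] by (simp add: Units_closed flip: m_assoc)
      with greater Units_closed[OF u[of i]] Units_inv_closed[OF u[of i]] Ac[of i j] show ?thesis
        by (simp add: U_eq LTDFM_simps N_def X_def diag_def)
    qed
    then have "A = N \<oplus>\<^bsub>LTDFM R\<^esub> diag e \<oplus>\<^bsub>LTDFM R\<^esub> U" by (intro ext)
    with Nnil Uunit diag_idempotent[of e, OF e] show ?thesis by blast
  qed
  then show ?thesis
    unfolding nil_good_clean_ring_def using L.ring_axioms by blast
qed

end
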